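(* Let $W_1,W_2$ be nonempty closed spherical convex subsets of $S^d$ such that $\mathcal{X}=W_1\cap W_2$ is nonempty. Then $\widehat{\mathcal{X}}=\mathcal{X}\cup-\mathcal{X}$ is the separation center set of $W_1^\circ$ and $-W_2^\circ$, i.e. $$\widehat{\mathcal{X}}=\mathcal{C}(W_1^\circ,-W_2^\circ)\cup\mathcal{C}(-W_2^\circ,W_1^\circ).$$
   Context: $S^d$ is the unit sphere of $\mathbb{R}^{d+1}$ with scalar product $P\cdot Q$, and $H(P)=\{Q\in S^d\mid P\cdot Q\geq0\}$. A set $W\subset S^d$ is hemispherical if $W\cap H(P)=\emptyset$ for some $P\in S^d$; a hemispherical set $W$ is spherical convex if $\frac{tP+(1-t)Q}{\|tP+(1-t)Q\|}\in W$ for all $P,Q\in W$, $t\in[0,1]$. The spherical polar set of $W\subset S^d$ is $W^\circ=\bigcap_{P\in W}H(P)$. For $W_1,W_2\subset S^d$, $$\mathcal{C}(W_1,W_2)=\{P\in S^d\mid P\cdot Q\ge0\ \text{for any }Q\in W_1\ \text{and}\ P\cdot R\le0\ \text{for any }R\in W_2\},$$ and $\mathcal{C}(W_1,W_2)\cup\mathcal{C}(W_2,W_1)$ is the separation center set of $W_1,W_2$. *)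

theory Defs
  imports "HOL-Analysis.Analysis"
begin

text \<open>
  The sphere \<open>S\<^sup>d\<close> is \<open>sphere 0 1\<close> in a Euclidean space \<open>'a\<close> with \<open>DIM('a) = d + 1\<close>.
  Since \<open>S\<^sup>d\<close> is closed in the ambient space, a subset of it is closed in \<open>S\<^sup>d\<close> if and only if
  it is \<open>closed\<close>.
\<close>

definition hemisphere :: "'a::euclidean_space \<Rightarrow> 'a set" where
  "hemisphere P = {Q \<in> sphere 0 1. P \<bullet> Q \<ge> 0}"

definition hemispherical :: "'a::euclidean_space set \<Rightarrow> bool" where
  "hemispherical W \<longleftrightarrow> W \<subseteq> sphere 0 1 \<and> (\<exists>P\<in>sphere 0 1. W \<inter> hemisphere P = {})"

definition spherical_convex :: "'a::euclidean_space set \<Rightarrow> bool" where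
  "spherical_convex W \<longleftrightarrow> hemispherical W \<and>
     (\<forall>P\<in>W. \<forall>Q\<in>W. \<forall>t\<in>{0..1}.
        (t *\<^sub>R P + (1 - t) *\<^sub>R Q) /\<^sub>R norm (t *\<^sub>R P + (1 - t) *\<^sub>R Q) \<in> W)"

text \<open>
  The intersection is taken inside the sphere, so that the polar of the empty set is the
  whole sphere and not \<open>UNIV\<close>.
\<close>

definition spherical_polar :: "'a::euclidean_space set \<Rightarrow> 'a set" where
  "spherical_polar W = sphere 0 1 \<inter> (\<Inter>P\<in>W. hemisphere P)"

definition separation_centers :: "'a::euclidean_space set \<Rightarrow> 'a set \<Rightarrow> 'a set" where
  "separation_centers W1 W2 =
     {P \<in> sphere 0 1. (\<forall>Q\<in>W1. P \<bullet> Q \<ge> 0) \<and> (\<forall>R\<in>W2. P \<bullet> R \<le> 0)}"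

definition separation_center_set :: "'a::euclidean_space set \<Rightarrow> 'a set \<Rightarrow> 'a set" where
  "separation_center_set W1 W2 = separation_centers W1 W2 \<union> separation_centers W2 W1"

end

theory Submission
  imports Defs
begin

text \<open>
  Everything reduces to the spherical bipolar theorem \<open>W\<^sup>\<circ>\<^sup>\<circ> = W\<close>: moving the sign across the inner
  product, the first set of separation centers is \<open>W1\<^sup>\<circ>\<^sup>\<circ> \<inter> W2\<^sup>\<circ>\<^sup>\<circ>\<close> and the second one is its negative.
  For a point \<open>P\<close> of the sphere outside \<open>W\<close>, the ray through \<open>P\<close> misses the compact convex hull of
  \<open>W\<close>; a hyperplane strictly separating the two, tilted slightly away from \<open>P\<close>, gives a point of the
  polar of \<open>W\<close> that has negative inner product with \<open>P\<close>.
\<close>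

lemma spherical_convex_norm_eq_1: "spherical_convex W \<Longrightarrow> w \<in> W \<Longrightarrow> norm w = 1"
  by (auto simp: spherical_convex_def hemispherical_def)

text \<open>An open half-space around \<open>W\<close> is convex, so it also contains the hull, but
  it omits 0. This excludes the origin, which every ray used below contains.\<close>

lemma hemispherical_zero_notin_convex_hull:
  assumes "hemispherical W"
  shows "0 \<notin> convex hull W"
proof -
  obtain P where W: "W \<subseteq> sphere 0 1" and P: "W \<inter> hemisphere P = {}"
    using assms by (auto simp: hemispherical_def)
  have "W \<subseteq> {x. P \<bullet> x < 0}"
    using W P by (fastforce simp: hemisphere_def)
  then have "convex hull W \<subseteq> {x. P \<bullet> x < 0}"
    by (rule hull_minimal) (rule convex_halfspace_lt)
  then show ?thesis by auto
qed

text \<open>Dividing the weights of \<open>p\<close> and \<open>q\<close> by their sum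
  \<open>s\<close> turns a nonnegative combination into a multiple of a convex one, whose
  normalisation stays in \<open>W\<close>. Since this cone contains \<open>W\<close>, each point of
  the hull is then a nonnegative multiple of a point of \<open>W\<close>.\<close>

lemma spherical_convex_imp_convex_cone:
  assumes "spherical_convex W"
  shows "convex {c *\<^sub>R w | c w. 0 \<le> c \<and> w \<in> W}" (is "convex ?C")
proof (rule convexI)
  fix x y :: 'a and u v :: real
  assume x: "x \<in> ?C" and y: "y \<in> ?C" and uv: "0 \<le> u" "0 \<le> v" "u + v = 1"
  obtain a p where x_eq: "x = a *\<^sub>R p" and p: "0 \<le> a" "p \<in> W" using x by blast
  obtain b q where y_eq: "y = b *\<^sub>R q" and q: "0 \<le> b" "q \<in> W" using y by blast
  define s where "s = u * a + v * b"
  have nonneg: "0 \<le> u * a" "0 \<le> v * b" using uv p q by auto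
  show "u *\<^sub>R x + v *\<^sub>R y \<in> ?C"
  proof (cases "s = 0")
    case True
    then have "u * a = 0" "v * b = 0" using nonneg unfolding s_def by linarith+
    then have "u *\<^sub>R x + v *\<^sub>R y = 0 *\<^sub>R p" by (auto simp: x_eq y_eq)
    then show ?thesis using p by blast
  next
    case False
    then have s: "s > 0" using nonneg unfolding s_def by linarith
    define t where "t = u * a / s"
    have t: "t \<in> {0..1}" using s nonneg by (auto simp: t_def s_def)
    have st: "s * t = u * a" "s * (1 - t) = v * b"
      using s by (auto simp: t_def s_def field_simps)
    define z where "z = t *\<^sub>R p + (1 - t) *\<^sub>R q"
    have "u *\<^sub>R x + v *\<^sub>R y = s *\<^sub>R z"
      by (simp add: x_eq y_eq z_def scaleR_add_right st)
    \<comment> \<open>For \<open>z = 0\<close> both sides vanish, because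
      \<open>inverse 0 = 0\<close>.\<close>
    also have "\<dots> = (s * norm z) *\<^sub>R (z /\<^sub>R norm z)"
      by (cases "z = 0") simp_all
    finally have eq: "u *\<^sub>R x + v *\<^sub>R y = (s * norm z) *\<^sub>R (z /\<^sub>R norm z)" .
    have "z /\<^sub>R norm z \<in> W"
      using assms p q t unfolding spherical_convex_def z_def by blast
    moreover have "0 \<le> s * norm z" using s by simp
    ultimately show ?thesis using eq by blast
  qed
qed

text \<open>A common point is both \<open>c\<close> times \<open>P\<close> and \<open>s\<close>
  times some \<open>w\<close> in \<open>W\<close>; taking norms gives \<open>c = s\<close>. If
  \<open>c\<close> is positive, cancelling it puts \<open>P\<close> in \<open>W\<close>; if
  \<open>c = 0\<close>, the origin would lie in the hull.\<close>

lemma ray_disjoint_convex_hull: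
  assumes W: "spherical_convex W" and P: "norm P = 1" "P \<notin> W"
  shows "(\<lambda>c. c *\<^sub>R P) ` {0..} \<inter> convex hull W = {}"
proof -
  note sph = spherical_convex_norm_eq_1[OF W]
  have "W \<subseteq> {c *\<^sub>R w | c w. 0 \<le> c \<and> w \<in> W}"
    by (force intro: exI[of _ 1])
  then have hull: "convex hull W \<subseteq> {c *\<^sub>R w | c w. 0 \<le> c \<and> w \<in> W}"
    by (rule hull_minimal) (rule spherical_convex_imp_convex_cone[OF W])
  have "c *\<^sub>R P \<notin> convex hull W" if c: "0 \<le> c" for c
  proof
    assume in_hull: "c *\<^sub>R P \<in> convex hull W"
    then obtain s w where sw: "c *\<^sub>R P = s *\<^sub>R w" "0 \<le> s" "w \<in> W"
      using hull by blast
    have "c = norm (c *\<^sub>R P)" using c P by simp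
    also have "\<dots> = s" using sw(2) sph[OF sw(3)] unfolding sw(1) by simp
    finally have "c = s" .
    then show False
      using hemispherical_zero_notin_convex_hull[of W] W in_hull sw P
      by (cases "c = 0") (auto simp: spherical_convex_def)
  qed
  then show ?thesis by auto
qed

lemma mem_spherical_polar:
  "Q \<in> spherical_polar W \<longleftrightarrow> norm Q = 1 \<and> (\<forall>w\<in>W. 0 \<le> w \<bullet> Q)"
  by (auto simp: spherical_polar_def hemisphere_def)

lemma spherical_polar_separates:
  assumes W: "closed W" "spherical_convex W" and ne: "W \<noteq> {}"
    and P: "norm P = 1" "P \<notin> W"
  obtains Q where "Q \<in> spherical_polar W" "Q \<bullet> P < 0"
proof -
  note sph = spherical_convex_norm_eq_1[OF W(2)]
  have "bounded W" using sph by (auto simp: bounded_iff)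
  then have compact: "compact (convex hull W)"
    using W by (intro compact_convex_hull) (simp add: compact_eq_bounded_closed)
  \<comment> \<open>Separating the whole ray, and not just \<open>P\<close>, forces
    \<open>0 < b\<close> (take \<open>c = 0\<close>) and
    \<open>a \<bullet> P \<le> 0\<close>.\<close>
  define R where "R = (\<lambda>c. c *\<^sub>R P) ` {0..}"
  have lin: "linear (\<lambda>c. c *\<^sub>R P)" by (simp add: linear_scaleR_left)
  have "inj (\<lambda>c. c *\<^sub>R P)" using P by (auto simp: inj_on_def)
  then have "closed R"
    unfolding R_def using lin by (intro closed_injective_linear_image) auto
  moreover have "convex R"
    unfolding R_def by (intro convex_linear_image lin) simp
  moreover have "R \<inter> convex hull W = {}"
    unfolding R_def by (rule ray_disjoint_convex_hull[OF W(2) P])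
  moreover have "convex hull W \<noteq> {}" using ne by simp
  ultimately have "\<exists>a b. (\<forall>x\<in>R. a \<bullet> x < b) \<and> (\<forall>x\<in>convex hull W. a \<bullet> x > b)"
    by (intro separating_hyperplane_closed_compact compact convex_convex_hull)
  then obtain a b where ray: "\<And>c. 0 \<le> c \<Longrightarrow> a \<bullet> (c *\<^sub>R P) < b"
    and hull: "\<And>x. x \<in> convex hull W \<Longrightarrow> b < a \<bullet> x"
    unfolding R_def by auto
  have "0 < b" using ray[of 0] by simp
  have aP: "a \<bullet> P \<le> 0"
  proof (rule ccontr)
    assume "\<not> a \<bullet> P \<le> 0"
    \<comment> \<open>A positive \<open>a \<bullet> P\<close> would let the ray reach the hyperplane
      \<open>a \<bullet> x = b\<close> at this parameter.\<close>
    then show False using ray[of "b / (a \<bullet> P)"] \<open>0 < b\<close> by simp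
  qed
  \<comment> \<open>The tilt makes the product with \<open>P\<close> strictly negative even if
    \<open>a \<bullet> P = 0\<close>. Its size \<open>b\<close> is affordable: on \<open>W\<close>
    it costs at most \<open>b\<close>, as \<open>P \<bullet> w \<le> 1\<close>, while
    \<open>a \<bullet> w\<close> exceeds \<open>b\<close>.\<close>
  define q where "q = a - b *\<^sub>R P"
  have qP: "q \<bullet> P < 0"
    using aP \<open>0 < b\<close> P by (simp add: q_def inner_diff_left dot_square_norm)
  have qW: "0 \<le> w \<bullet> q" if "w \<in> W" for w
  proof -
    have "P \<bullet> w \<le> 1" using norm_cauchy_schwarz[of P w] P sph[OF that] by simp
    then have "b * (P \<bullet> w) \<le> b" using \<open>0 < b\<close> by simp
    moreover have "b < a \<bullet> w" using hull that by (simp add: hull_inc)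
    ultimately show ?thesis by (simp add: q_def inner_diff_right inner_commute)
  qed
  have "q \<noteq> 0" using qP by auto
  then have "q /\<^sub>R norm q \<in> spherical_polar W"
    using qW by (simp add: mem_spherical_polar)
  moreover have "(q /\<^sub>R norm q) \<bullet> P < 0"
    using qP \<open>q \<noteq> 0\<close> by (simp add: mult_pos_neg)
  ultimately show thesis by (rule that)
qed

theorem spherical_bipolar:
  assumes "closed W" "spherical_convex W" "W \<noteq> {}"
  shows "spherical_polar (spherical_polar W) = W"
proof
  show "spherical_polar (spherical_polar W) \<subseteq> W"
  proof
    fix P assume P: "P \<in> spherical_polar (spherical_polar W)"
    show "P \<in> W"
    proof (rule ccontr)
      assume "P \<notin> W"
      then obtain Q where "Q \<in> spherical_polar W" "Q \<bullet> P < 0"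
        using spherical_polar_separates assms P by (metis mem_spherical_polar)
      then show False using P unfolding mem_spherical_polar[of P] by force
    qed
  qed
  show "W \<subseteq> spherical_polar (spherical_polar W)"
    using spherical_convex_norm_eq_1[OF assms(2)]
    by (metis inner_commute mem_spherical_polar subsetI)
qed

lemma separation_centers_uminus_right:
  "separation_centers A (uminus ` B) = spherical_polar A \<inter> spherical_polar B"
  by (auto simp: separation_centers_def mem_spherical_polar inner_commute)

text \<open>Negating a center flips both inequalities, which exchanges the roles of the two
  sets.\<close>

lemma separation_centers_commute:
  "separation_centers A B = uminus ` separation_centers B A"
proof -
  have "P \<in> separation_centers A B \<longleftrightarrow> - P \<in> separation_centers B A" for P
    by (auto simp: separation_centers_def)
  then show ?thesis by (force simp: image_iff intro: bexI[of _ "- _"])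
qed

theorem proposition3:
  fixes W1 W2 :: "'a::euclidean_space set"
  assumes "W1 \<noteq> {}" and "closed W1" and "spherical_convex W1"
    and "W2 \<noteq> {}" and "closed W2" and "spherical_convex W2"
    and "W1 \<inter> W2 \<noteq> {}"
  shows "(W1 \<inter> W2) \<union> uminus ` (W1 \<inter> W2) =
    separation_center_set (spherical_polar W1) (uminus ` spherical_polar W2)"
proof -
  have "separation_centers (spherical_polar W1) (uminus ` spherical_polar W2) = W1 \<inter> W2"
    using assms by (simp add: separation_centers_uminus_right spherical_bipolar)
  then show ?thesis
    unfolding separation_center_set_def
    by (simp add: separation_centers_commute[of "uminus ` spherical_polar W2"])
qed

end
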